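(* Let $\alpha>0$ and $\beta\ge 0$ be real numbers, and let $f\in\mathcal{A}$ satisfy $f(z)f'(z)/z\neq 0$ for all $z\in\mathbb{D}$. If at least one of the following inequalities holds for all $z\in\mathbb{D}$: (i) $\operatorname{Re}\big(\beta Q_{SD}Q_{ST}+\alpha Q_{CV}(1+Q_{ST})\big)>-\alpha/2$; (ii) $\operatorname{Re}\big(\beta Q_{SD}Q_{CV}+\alpha Q_{ST}(1+Q_{CV})\big)>-\alpha/2$; (iii) $\operatorname{Re}\big(\beta Q_{SD}Q_{CV}+\alpha Q_{CV}(1+Q_{ST})\big)>-\alpha/2$; (iv) $\operatorname{Re}\big(\beta Q_{SD}Q_{ST}+\alpha Q_{ST}(1+Q_{CV})\big)>-\alpha/2$; then $f$ is starlike.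
   Context: $\mathbb{D}=\{z\in\mathbb{C}:|z|<1\}$. $\mathcal{A}$ is the class of analytic functions $f:\mathbb{D}\to\mathbb{C}$ with $f(0)=0$ and $f'(0)=1$. For $f\in\mathcal{A}$, as functions of $z\in\mathbb{D}$: $Q_{ST}=zf'(z)/f(z)$ (with the removable singularity at $z=0$ filled in, value $1$), $Q_{CV}=1+zf''(z)/f'(z)$, and $Q_{SD}=z^2\Big(\big(f''(z)/f'(z)\big)'-\tfrac12\big(f''(z)/f'(z)\big)^2\Big)$ ($z^2$ times the Schwarzian derivative of $f$). The condition $f(z)f'(z)/z\neq0$ is understood at $z=0$ via the removable singularity (where the value is $1$). A function $f\in\mathcal{A}$ is starlike if $\operatorname{Re}Q_{ST}>0$ on $\mathbb{D}$; equivalently, $f$ is univalent and $tf(z)\in f(\mathbb{D})$ for all $z\in\mathbb{D}$, $t\in[0,1]$. *)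

theory Defs
  imports "HOL-Complex_Analysis.Complex_Analysis"
begin

abbreviation unit_disc :: "complex set" where
  "unit_disc \<equiv> ball 0 1"

text \<open>Functions are total on \<^typ>\<open>complex\<close>; only their values on the unit disc matter.\<close>

definition class_A :: "(complex \<Rightarrow> complex) set" where
  "class_A = {f. f holomorphic_on unit_disc \<and> f 0 = 0 \<and> deriv f 0 = 1}"

text \<open>For \<open>f\<close> in \<^const>\<open>class_A\<close>, both \<open>f z * f' z / z\<close> and \<open>z * f' z / f z\<close> have a
  removable singularity at \<open>0\<close> with limit \<open>1\<close>. The value there is given explicitly, because
  division by zero yields \<open>0\<close> in HOL.\<close>

definition ffz :: "(complex \<Rightarrow> complex) \<Rightarrow> complex \<Rightarrow> complex" where
  "ffz f z = (if z = 0 then 1 else f z * deriv f z / z)"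

definition Q_ST :: "(complex \<Rightarrow> complex) \<Rightarrow> complex \<Rightarrow> complex" where
  "Q_ST f z = (if z = 0 then 1 else z * deriv f z / f z)"

definition Q_CV :: "(complex \<Rightarrow> complex) \<Rightarrow> complex \<Rightarrow> complex" where
  "Q_CV f z = 1 + z * deriv (deriv f) z / deriv f z"

definition schwarzian :: "(complex \<Rightarrow> complex) \<Rightarrow> complex \<Rightarrow> complex" where
  "schwarzian f z = deriv (\<lambda>w. deriv (deriv f) w / deriv f w) z
                    - 1 / 2 * (deriv (deriv f) z / deriv f z)\<^sup>2"

definition Q_SD :: "(complex \<Rightarrow> complex) \<Rightarrow> complex \<Rightarrow> complex" where
  "Q_SD f z = z\<^sup>2 * schwarzian f z"

definition starlike_fun :: "(complex \<Rightarrow> complex) \<Rightarrow> bool" where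
  "starlike_fun f \<longleftrightarrow> f \<in> class_A \<and> (\<forall>z\<in>unit_disc. Re (Q_ST f z) > 0)"

end

theory Submission
  imports Defs
begin

text \<open>
  Write \<open>p = Q_ST f\<close>, \<open>q = Q_CV f\<close> and \<open>s = Q_SD f\<close>. Then \<open>p\<close> is holomorphic on the disc with
  \<open>p 0 = 1\<close>, and the task is to show \<open>Re p > 0\<close>. Logarithmic differentiation gives \<open>q = p + z p'/p\<close>
  and \<open>s = z q' + (1 - q\<^sup>2)/2\<close>, so each of the four expressions is a second-order differential
  expression in \<open>p\<close>. The method is the differential subordination argument of Miller and Mocanu.

  If \<open>Re p\<close> is not positive everywhere, take a point \<open>z0\<close> of least modulus with \<open>Re (p z0) = 0\<close>,
  say \<open>p z0 = i x\<close> with \<open>x\<close> real (lemma \<open>first_zero_of_Re\<close>). On the circle through \<open>z0\<close> the function \<open>Re p\<close> has a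
  minimum at \<open>z0\<close>, so its first and second tangential derivatives there are zero and
  nonnegative. This says that \<open>y = z0 p'(z0)\<close> is real and that \<open>W = z0 (z p')'(z0)\<close> satisfies
  \<open>Re W \<le> 0\<close> (lemma \<open>circle_min_of_Re\<close>). In the radial direction, the Schwarz lemma for
  the Cayley transform \<open>(1 - p)/(1 + p)\<close> yields \<open>y \<le> - (1 + x\<^sup>2)/2\<close> (lemma \<open>radial_derivative_bound\<close>).

  At \<open>z0\<close> both \<open>p\<close> and \<open>q = i (x - y/x)\<close> are purely imaginary, with
  \<open>p q = y - x\<^sup>2 \<le> - 1/2\<close>. Moreover \<open>s\<close> is a real number plus \<open>W/p\<close>, so that \<open>Re (s p) = Re W \<le> 0\<close> and
  \<open>Re (s q) = (1 - y/x\<^sup>2) Re W \<le> 0\<close> (lemma \<open>Q_at_first_zero\<close>). Hence the \<open>\<beta>\<close>-term of each of the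
  four expressions has real part at most \<open>0\<close>, and the \<open>\<alpha>\<close>-term has real part at most \<open>- \<alpha>/2\<close>: all
  four inequalities fail at the same point \<open>z0\<close>.
\<close>

section \<open>The first zero of the real part of a holomorphic function\<close>


text \<open>
  The norm attains its infimum on the compact set of those points of the closed disc of radius
  \<open>norm z\<close> where \<open>Re p \<le> 0\<close>. Minimality makes \<open>Re p\<close> positive on the open disc through
  the minimiser, and continuity makes it nonnegative on the closed one.
\<close>
lemma first_zero_of_Re:
  fixes p :: "complex \<Rightarrow> complex"
  assumes cont: "continuous_on (ball 0 1) p" and p0: "Re (p 0) > 0"
    and z: "z \<in> ball 0 1" "Re (p z) \<le> 0"
  obtains z0 where "z0 \<in> ball 0 1" "z0 \<noteq> 0" "Re (p z0) = 0"
    "\<And>w. norm w < norm z0 \<Longrightarrow> Re (p w) > 0"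
    "\<And>w. norm w \<le> norm z0 \<Longrightarrow> Re (p w) \<ge> 0"
proof -
  define K where "K = {w \<in> cball 0 (norm z). Re (p w) \<le> 0}"
  have sub: "cball 0 (norm z) \<subseteq> ball (0::complex) 1"
    using z by auto
  have contRe: "continuous_on (cball 0 (norm z)) (\<lambda>w. Re (p w))"
    by (intro continuous_intros continuous_on_subset[OF cont sub])
  have "compact K"
  proof -
    have "K = cball 0 (norm z) \<inter> (\<lambda>w. Re (p w)) -` {..0}"
      unfolding K_def by auto
    moreover have "closed \<dots>"
      by (rule continuous_closed_preimage[OF contRe]) auto
    moreover have "bounded K"
      unfolding K_def by (rule bounded_subset[OF bounded_cball[of 0 "norm z"]]) auto
    ultimately show ?thesis
      by (simp add: compact_eq_bounded_closed)
  qed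
  moreover have "K \<noteq> {}"
    using z by (auto simp: K_def)
  ultimately obtain z0 where z0: "z0 \<in> K" "\<And>w. w \<in> K \<Longrightarrow> norm z0 \<le> norm w"
    using continuous_attains_inf[of K norm] continuous_on_norm_id by blast
  have z0z: "norm z0 \<le> norm z" and le: "Re (p z0) \<le> 0"
    using z0(1) by (auto simp: K_def)
  have inside: "Re (p w) > 0" if "norm w < norm z0" for w
    using z0(2)[of w] that z0z by (force simp: K_def)
  have "z0 \<noteq> 0"
    using le p0 by auto
  have clos: "Re (p w) \<ge> 0" if "norm w \<le> norm z0" for w
  proof (rule continuous_ge_on_closure[where S = "ball 0 (norm z0)" and f = "\<lambda>w. Re (p w)"])
    have c: "closure (ball 0 (norm z0)) = cball (0::complex) (norm z0)"
      using \<open>z0 \<noteq> 0\<close> by simp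
    show "continuous_on (closure (ball 0 (norm z0))) (\<lambda>w. Re (p w))"
      unfolding c using z0z by (intro continuous_on_subset[OF contRe]) auto
    show "w \<in> closure (ball 0 (norm z0))"
      unfolding c using that by simp
  qed (use inside less_imp_le in auto)
  show thesis
  proof (rule that)
    show "z0 \<in> ball 0 1" using z0z z by simp
    show "Re (p z0) = 0" using clos[of z0] le by simp
  qed (use \<open>z0 \<noteq> 0\<close> inside clos in auto)
qed

lemma second_derivative_nonneg_at_min:
  fixes g g' :: "real \<Rightarrow> real"
  assumes g: "\<And>t. (g has_real_derivative g' t) (at t)"
    and g': "(g' has_real_derivative l) (at a)"
    and min: "\<And>t. g a \<le> g t"
  shows "g' a = 0" and "l \<ge> 0"
proof -
  show 0: "g' a = 0"
    by (rule DERIV_local_min[OF g[of a], of 1]) (use min in auto)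
  show "l \<ge> 0"
  proof (rule ccontr)
    assume "\<not> l \<ge> 0"
    then obtain d where d: "d > 0" "\<And>h. h > 0 \<Longrightarrow> h < d \<Longrightarrow> g' (a + h) < 0"
      using DERIV_neg_dec_right[OF g'] 0 by auto
    have "g (a + d/2) < g a"
    proof (rule DERIV_neg_imp_decreasing_open[where f = g and a = a])
      show "a < a + d/2" using d by simp
      show "continuous_on {a..a + d/2} g"
        by (meson DERIV_isCont continuous_at_imp_continuous_on g)
      show "\<exists>y. (g has_real_derivative y) (at x) \<and> y < 0"
        if "a < x" "x < a + d/2" for x
        using that g[of x] d(2)[of "x - a"] by auto
    qed
    then show False
      using min[of "a + d/2"] by simp
  qed
qed

text \<open>
  Along the curve \<open>z0 * exp (i t)\<close> differentiation in \<open>t\<close> is \<open>i\<close> times the operator \<open>z d/dz\<close>.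
  So the first two tangential derivatives of \<open>Re p\<close> are \<open>- Im (z p')\<close> and \<open>- Re (z (z p')')\<close>,
  and the conditions for a minimum are exactly the two conclusions.
\<close>
lemma circle_min_of_Re:
  assumes hol: "p holomorphic_on S" and S: "open S" "sphere 0 (norm z0) \<subseteq> S"
    and min: "\<And>w. norm w = norm z0 \<Longrightarrow> Re (p z0) \<le> Re (p w)"
  shows "Im (z0 * deriv p z0) = 0"
    and "Re (z0 * deriv (\<lambda>z. z * deriv p z) z0) \<le> 0"
proof -
  define D where "D = (\<lambda>z. z * deriv p z)"
  define c where "c = (\<lambda>t. z0 * exp (\<i> * complex_of_real t))"
  have holD: "D holomorphic_on S"
    unfolding D_def by (intro holomorphic_intros holomorphic_deriv hol S)
  have nc: "norm (c t) = norm z0" for t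
    by (simp add: c_def norm_mult)
  then have cS: "c t \<in> S" for t
    using S(2) by auto
  have dc: "(c has_vector_derivative (\<i> * c t)) (at t)" for t
    unfolding c_def by (auto intro!: derivative_eq_intros has_vector_derivative_real_field)
  have c0: "c 0 = z0"
    by (simp add: c_def)
  have d1: "((\<lambda>t. Re (p (c t))) has_real_derivative - Im (D (c t))) (at t)" for t
  proof -
    have "(p has_field_derivative deriv p (c t)) (at (c t))"
      using holomorphic_derivI[OF hol S(1) cS] .
    from has_field_derivative_Re[OF field_vector_diff_chain_at[OF dc this]]
    show ?thesis
      by (simp add: o_def D_def mult.assoc)
  qed
  have d2: "((\<lambda>t. - Im (D (c t))) has_real_derivative - Re (z0 * deriv D z0)) (at 0)"
  proof -
    have "(D has_field_derivative deriv D (c 0)) (at (c 0))"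
      using holomorphic_derivI[OF holD S(1) cS] .
    from DERIV_minus[OF has_field_derivative_Im[OF field_vector_diff_chain_at[OF dc this]]]
    show ?thesis
      by (simp add: o_def c0)
  qed
  have m: "Re (p (c 0)) \<le> Re (p (c t))" for t
    using min nc by (simp add: c0)
  show "Im (z0 * deriv p z0) = 0"
    using second_derivative_nonneg_at_min(1)[OF d1 d2 m] by (simp add: c0 D_def)
  show "Re (z0 * deriv (\<lambda>z. z * deriv p z) z0) \<le> 0"
    using second_derivative_nonneg_at_min(2)[OF d1 d2 m] by (simp add: D_def)
qed

text \<open>
  A quantitative form of the Hopf boundary lemma. The Cayley transform of \<open>p\<close>, rescaled by \<open>z0\<close>,
  maps the unit disc into itself and fixes \<open>0\<close>. By the Schwarz lemma its modulus at \<open>t\<close> is at most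
  \<open>t\<close>, with equality at \<open>t = 1\<close> because \<open>p z0\<close> is purely imaginary. Comparing the one-sided
  derivatives at \<open>t = 1\<close> gives the bound.
\<close>
lemma radial_derivative_bound:
  assumes hol: "p holomorphic_on S" and S: "open S" "cball 0 (norm z0) \<subseteq> S"
    and p0: "p 0 = 1" and "z0 \<noteq> 0" and Re0: "Re (p z0) = 0"
    and pos: "\<And>w. norm w < norm z0 \<Longrightarrow> Re (p w) > 0"
  shows "Re (z0 * deriv p z0) \<le> - (1 + (Im (p z0))\<^sup>2) / 2"
proof -
  define \<phi> where "\<phi> = (\<lambda>\<zeta>. (1 - p (z0 * \<zeta>)) / (1 + p (z0 * \<zeta>)))"
  have small: "norm (z0 * \<zeta>) < norm z0" if "norm \<zeta> < 1" for \<zeta>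
    using that \<open>z0 \<noteq> 0\<close> by (simp add: norm_mult)
  have lt: "norm (1 - p (z0 * \<zeta>)) < norm (1 + p (z0 * \<zeta>))" if "norm \<zeta> < 1" for \<zeta>
    using pos[OF small[OF that]] unfolding cmod_def
    by (intro real_sqrt_less_mono) (simp add: power2_eq_square algebra_simps)
  have ne: "1 + p (z0 * \<zeta>) \<noteq> 0" if "norm \<zeta> < 1" for \<zeta>
    using lt[OF that] by auto
  have Schwarz: "norm (\<phi> \<zeta>) \<le> norm \<zeta>" if "norm \<zeta> < 1" for \<zeta>
  proof (rule Schwarz_Lemma(1)[OF _ _ _ that])
    have "(\<lambda>\<zeta>. p (z0 * \<zeta>)) holomorphic_on ball 0 1"
      using holomorphic_on_compose_gen[of "\<lambda>\<zeta>. z0 * \<zeta>" "ball 0 1" p S] S(2) small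
      by (force simp: o_def hol intro!: holomorphic_intros dest: less_imp_le)
    then show "\<phi> holomorphic_on ball 0 1"
      unfolding \<phi>_def by (intro holomorphic_intros) (auto simp: ne)
    show "\<phi> 0 = 0"
      by (simp add: \<phi>_def p0)
    show "norm (\<phi> \<zeta>) < 1" if "norm \<zeta> < 1" for \<zeta>
      using lt[OF that] ne[OF that] by (simp add: \<phi>_def norm_divide)
  qed
  define a b where "a = (\<lambda>t. Re (p (z0 * complex_of_real t)))"
    and "b = (\<lambda>t. Im (p (z0 * complex_of_real t)))"
  \<comment> \<open>This is \<open>t\<^sup>2 |1 + p|\<^sup>2 - |1 - p|\<^sup>2\<close> at \<open>z0 t\<close>. Clearing the denominator of the Cayley transform
      leaves a function that is differentiable at \<open>t = 1\<close> by inspection.\<close>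
  define g where "g = (\<lambda>t. t\<^sup>2 * ((1 + a t)\<^sup>2 + (b t)\<^sup>2) - ((1 - a t)\<^sup>2 + (b t)\<^sup>2))"
  have g_nonneg: "g t \<ge> 0" if "0 < t" "t < 1" for t
  proof -
    have "norm (\<phi> t) \<le> t"
      using Schwarz[of t] that by simp
    then have "norm (1 - p (z0 * t)) \<le> t * norm (1 + p (z0 * t))"
      using ne[of t] that by (simp add: \<phi>_def norm_divide field_simps)
    then have "(norm (1 - p (z0 * t)))\<^sup>2 \<le> (t * norm (1 + p (z0 * t)))\<^sup>2"
      by (intro power_mono) auto
    then show ?thesis
      by (simp add: g_def a_def b_def cmod_power2 power_mult_distrib)
  qed
  have "(p has_field_derivative deriv p z0) (at (z0 * complex_of_real 1))"
    using holomorphic_derivI[OF hol S(1), of z0] S(2) by auto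
  moreover have "((\<lambda>t. z0 * complex_of_real t) has_vector_derivative z0) (at 1)"
    by (auto intro!: derivative_eq_intros has_vector_derivative_real_field)
  ultimately have dp: "((\<lambda>t. p (z0 * complex_of_real t)) has_vector_derivative z0 * deriv p z0) (at 1)"
    using field_vector_diff_chain_at by (fastforce simp: o_def)
  have da: "(a has_real_derivative Re (z0 * deriv p z0)) (at 1)"
    using has_field_derivative_Re[OF dp]
    by (simp add: a_def)
  have db: "(b has_real_derivative Im (z0 * deriv p z0)) (at 1)"
    using has_field_derivative_Im[OF dp]
    by (simp add: b_def)
  have a1: "a 1 = 0" and b1: "b 1 = Im (p z0)"
    by (simp_all add: a_def b_def Re0)
  have dg: "(g has_real_derivative 2 * (1 + (Im (p z0))\<^sup>2) + 4 * Re (z0 * deriv p z0)) (at 1)"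
    unfolding g_def by (auto intro!: derivative_eq_intros da db simp: a1 b1 algebra_simps)
  have g1: "g 1 = 0"
    by (simp add: g_def a1)
  have "2 * (1 + (Im (p z0))\<^sup>2) + 4 * Re (z0 * deriv p z0) \<le> 0"
  proof (rule ccontr)
    assume "\<not> ?thesis"
    then obtain d where d: "d > 0" "\<And>h. h > 0 \<Longrightarrow> h < d \<Longrightarrow> g (1 - h) < g 1"
      using DERIV_pos_inc_left[OF dg] by auto
    define h where "h = min (d/2) (1/2)"
    have "h > 0" "h < d" "h < 1"
      using d(1) by (auto simp: h_def)
    then show False
      using d(2)[of h] g_nonneg[of "1 - h"] g1 by auto
  qed
  then show ?thesis
    by simp
qed

lemma first_zero_of_Re_derivatives:
  assumes hol: "p holomorphic_on ball 0 1" and p0: "p 0 = 1"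
    and z: "z \<in> ball 0 1" "Re (p z) \<le> 0"
  obtains z0 x y where "z0 \<in> ball 0 1" "z0 \<noteq> 0"
    "p z0 = \<i> * complex_of_real x" "z0 * deriv p z0 = complex_of_real y"
    "y \<le> - (1 + x\<^sup>2) / 2" "Re (z0 * deriv (\<lambda>z. z * deriv p z) z0) \<le> 0"
proof -
  obtain z0 where z0: "z0 \<in> ball 0 1" "z0 \<noteq> 0" "Re (p z0) = 0"
    "\<And>w. norm w < norm z0 \<Longrightarrow> Re (p w) > 0"
    "\<And>w. norm w \<le> norm z0 \<Longrightarrow> Re (p w) \<ge> 0"
    using first_zero_of_Re[OF holomorphic_on_imp_continuous_on[OF hol] _ z] p0 by auto
  have sub: "cball 0 (norm z0) \<subseteq> ball (0::complex) 1" "sphere 0 (norm z0) \<subseteq> ball (0::complex) 1"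
    using z0(1) by auto
  have circ: "Im (z0 * deriv p z0) = 0" "Re (z0 * deriv (\<lambda>z. z * deriv p z) z0) \<le> 0"
    by (rule circle_min_of_Re[OF hol open_ball sub(2)]; use z0 in simp)+
  have rad: "Re (z0 * deriv p z0) \<le> - (1 + (Im (p z0))\<^sup>2) / 2"
    by (rule radial_derivative_bound[OF hol open_ball sub(1) p0 z0(2-4)])
  show thesis
    by (rule that[OF z0(1,2) _ _ rad circ(2)]) (use circ z0(3) in \<open>simp_all add: complex_eq_iff\<close>)
qed

section \<open>The three quotients in terms of \<open>Q_ST\<close>\<close>

lemma ffz_nonzero_factors:
  assumes "\<forall>z\<in>unit_disc. ffz f z \<noteq> 0" "z \<in> unit_disc" "z \<noteq> 0"
  shows "f z \<noteq> 0" "deriv f z \<noteq> 0"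
  using assms(1)[rule_format, OF assms(2)] assms(3) by (auto simp: ffz_def)

text \<open>
  Writing \<open>f z = z h z\<close> with \<open>h\<close> holomorphic and zero-free exhibits the quotient as \<open>f'/h\<close>, which
  also takes the prescribed value \<open>1\<close> at the origin.
\<close>
lemma Q_ST_holomorphic:
  assumes f: "f \<in> class_A" and nz: "\<forall>z\<in>unit_disc. ffz f z \<noteq> 0"
  shows "Q_ST f holomorphic_on unit_disc"
proof -
  have hol: "f holomorphic_on unit_disc" and [simp]: "f 0 = 0" "deriv f 0 = 1"
    using f by (auto simp: class_A_def)
  obtain h where h: "h holomorphic_on unit_disc" "\<And>z. norm z < 1 \<Longrightarrow> f z = z * h z" "deriv f 0 = h 0"
    using Schwarz3[OF hol] by auto
  have hnz: "h z \<noteq> 0" if "z \<in> unit_disc" for z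
    using ffz_nonzero_factors(1)[OF nz that] h(2)[of z] h(3) that by (cases "z = 0") auto
  have "(\<lambda>z. deriv f z / h z) holomorphic_on unit_disc"
    by (intro holomorphic_intros h holomorphic_deriv hol) (use hnz in auto)
  then show ?thesis
    by (rule holomorphic_transform) (use h in \<open>auto simp: Q_ST_def\<close>)
qed

text \<open>The logarithmic derivative of \<open>z f'/f\<close>, multiplied by \<open>z\<close>, is \<open>1 + z f''/f' - z f'/f\<close>.\<close>
lemma Q_CV_eq:
  assumes f: "f \<in> class_A" and nz: "\<forall>z\<in>unit_disc. ffz f z \<noteq> 0"
    and z: "z \<in> unit_disc" "z \<noteq> 0"
  shows "Q_CV f z = Q_ST f z + z * deriv (Q_ST f) z / Q_ST f z"
proof -
  have hol: "f holomorphic_on unit_disc"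
    using f by (auto simp: class_A_def)
  note nz' = ffz_nonzero_factors[OF nz z]
  have df: "(f has_field_derivative deriv f z) (at z)"
    using holomorphic_derivI[OF hol open_ball z(1)] .
  have ddf: "(deriv f has_field_derivative deriv (deriv f) z) (at z)"
    using holomorphic_derivI[OF holomorphic_deriv[OF hol open_ball] open_ball z(1)] .
  have "((\<lambda>z. z * deriv f z / f z) has_field_derivative
     ((deriv f z + z * deriv (deriv f) z) * f z - z * deriv f z * deriv f z) / (f z * f z)) (at z)"
    by (rule derivative_eq_intros df ddf refl nz')+ (simp add: algebra_simps)
  then have "(Q_ST f has_field_derivative
     ((deriv f z + z * deriv (deriv f) z) * f z - z * deriv f z * deriv f z) / (f z * f z)) (at z)"
    by (rule has_field_derivative_transform_within_open[where S = "- {0}"])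
       (use z in \<open>auto simp: Q_ST_def\<close>)
  then show ?thesis
    using nz' z by (simp add: DERIV_imp_deriv Q_ST_def Q_CV_def field_simps)
qed

text \<open>
  With \<open>g = f''/f'\<close> the Schwarzian is \<open>g' - g\<^sup>2/2\<close> and \<open>Q_CV f = 1 + z g\<close>, hence
  \<open>z (Q_CV f)' = z g + z\<^sup>2 g'\<close>. Eliminating \<open>g\<close> and \<open>g'\<close> leaves a polynomial identity.
\<close>
lemma Q_SD_eq:
  assumes f: "f \<in> class_A" and nz: "\<forall>z\<in>unit_disc. ffz f z \<noteq> 0"
    and z: "z \<in> unit_disc" "z \<noteq> 0"
  shows "Q_SD f z = z * deriv (Q_CV f) z + (1 - (Q_CV f z)\<^sup>2) / 2"
proof -
  define g where "g = (\<lambda>w. deriv (deriv f) w / deriv f w)"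
  have hol: "f holomorphic_on unit_disc"
    using f by (auto simp: class_A_def)
  \<comment> \<open>The hypothesis on \<open>ffz\<close> controls \<open>deriv f\<close> away from the origin, and the claim is local.\<close>
  have "g holomorphic_on unit_disc - {0}"
    unfolding g_def
    by (intro holomorphic_intros holomorphic_on_subset[OF holomorphic_deriv[OF hol open_ball]]
         holomorphic_on_subset[OF holomorphic_deriv[OF holomorphic_deriv[OF hol open_ball] open_ball]])
       (use ffz_nonzero_factors[OF nz] in auto)
  then have dg: "(g has_field_derivative deriv g z) (at z)"
    using holomorphic_derivI[of g "unit_disc - {0}" z UNIV] z by auto
  have "Q_CV f = (\<lambda>w. 1 + w * g w)"
    by (rule ext) (simp add: Q_CV_def g_def)
  moreover have "((\<lambda>w. 1 + w * g w) has_field_derivative g z + z * deriv g z) (at z)"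
    by (auto intro!: derivative_eq_intros dg)
  ultimately have "deriv (Q_CV f) z = g z + z * deriv g z" "Q_CV f z = 1 + z * g z"
    by (simp_all add: DERIV_imp_deriv)
  moreover have "Q_SD f z = z\<^sup>2 * (deriv g z - 1 / 2 * (g z)\<^sup>2)"
    by (simp add: Q_SD_def schwarzian_def g_def)
  ultimately show ?thesis
    by (simp add: power2_eq_square field_simps)
qed

lemma deriv_Q_CV:
  assumes f: "f \<in> class_A" and nz: "\<forall>z\<in>unit_disc. ffz f z \<noteq> 0"
    and z: "z \<in> unit_disc" "z \<noteq> 0"
  defines "p \<equiv> Q_ST f"
  shows "z * deriv (Q_CV f) z = z * deriv p z + z * deriv (\<lambda>z. z * deriv p z) z / p z
     - (z * deriv p z)\<^sup>2 / (p z)\<^sup>2"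
proof -
  define D where "D = (\<lambda>z. z * deriv p z)"
  have hol: "p holomorphic_on unit_disc"
    unfolding p_def by (rule Q_ST_holomorphic[OF f nz])
  have holD: "D holomorphic_on unit_disc"
    unfolding D_def by (intro holomorphic_intros holomorphic_deriv hol open_ball)
  have pnz: "p z \<noteq> 0"
    using ffz_nonzero_factors[OF nz z] z by (simp add: p_def Q_ST_def)
  have "((\<lambda>w. p w + D w / p w) has_field_derivative
     deriv p z + (deriv D z * p z - D z * deriv p z) / (p z * p z)) (at z)"
    by (rule derivative_eq_intros holomorphic_derivI[OF hol open_ball z(1)]
         holomorphic_derivI[OF holD open_ball z(1)] refl pnz)+
  then have "(Q_CV f has_field_derivative
     deriv p z + (deriv D z * p z - D z * deriv p z) / (p z * p z)) (at z)"
    by (rule has_field_derivative_transform_within_open[where S = "unit_disc - {0}"])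
       (use z Q_CV_eq[OF f nz] in \<open>auto simp: p_def D_def\<close>)
  then show ?thesis
    using pnz unfolding D_def[symmetric]
    by (simp add: DERIV_imp_deriv power2_eq_square field_simps) (simp add: D_def algebra_simps)
qed

section \<open>Failure of the inequalities at a first zero\<close>

text \<open>
  Here \<open>p\<close>, \<open>q\<close>, \<open>s\<close> stand for the values of \<open>Q_ST f\<close>, \<open>Q_CV f\<close>, \<open>Q_SD f\<close> at a first zero of
  \<open>Re (Q_ST f)\<close>, and \<open>y\<close>, \<open>W\<close> for the values of \<open>z p'\<close> and \<open>z (z p')'\<close> there. In
  \<open>s\<close> every term but \<open>W / p\<close> is real, hence contributes nothing to the real part after
  multiplication by the imaginary numbers \<open>p\<close> and \<open>q\<close>. The remaining products are \<open>W\<close> and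
  \<open>W q / p\<close>, and \<open>q / p\<close> is a positive real number because \<open>y < 0\<close>.
\<close>
lemma Q_at_first_zero:
  fixes x y :: real and W :: complex
  assumes "x \<noteq> 0" and y: "y \<le> - (1 + x\<^sup>2) / 2" and W: "Re W \<le> 0"
    and p: "p = \<i> * complex_of_real x"
    and q: "q = p + of_real y / p"
    and s: "s = of_real y + W / p - (of_real y)\<^sup>2 / p\<^sup>2 + (1 - q\<^sup>2) / 2"
  shows "Re p = 0" "Re q = 0" "Re (p * q) \<le> - 1 / 2" "Re (s * p) \<le> 0" "Re (s * q) \<le> 0"
proof -
  define k where "k = x - y / x"
  define S where "S = y + y\<^sup>2 / x\<^sup>2 + (1 + k\<^sup>2) / 2"
  have q': "q = \<i> * of_real k"
    using \<open>x \<noteq> 0\<close> by (simp add: q p k_def complex_eq_iff Re_divide Im_divide power2_eq_square)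
  have s': "s = of_real S + W / p"
    by (simp add: s q' p S_def power_mult_distrib)
  show "Re p = 0" "Re q = 0"
    by (simp_all add: p q')
  have "Re (p * q) = y - x\<^sup>2"
    using \<open>x \<noteq> 0\<close> by (simp add: p q' k_def field_simps power2_eq_square)
  then show "Re (p * q) \<le> - 1 / 2"
    using y zero_le_power2[of x] by argo
  have "s * p = \<i> * of_real (S * x) + W"
    using \<open>x \<noteq> 0\<close> by (simp add: s' p field_simps)
  then show "Re (s * p) \<le> 0"
    using W by simp
  have "s * q = \<i> * of_real (S * k) + of_real (k / x) * W"
    using \<open>x \<noteq> 0\<close> by (simp add: s' q' p field_simps)
  then have "Re (s * q) = k / x * Re W"
    by simp
  moreover have "y \<le> 0"
    using y zero_le_power2[of x] by argo
  then have "y / x\<^sup>2 \<le> 0"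
    by (simp add: divide_nonpos_nonneg)
  then have "k / x \<ge> 0"
    using \<open>x \<noteq> 0\<close> by (simp add: k_def diff_divide_distrib power2_eq_square)
  ultimately show "Re (s * q) \<le> 0"
    using W by (metis mult_nonneg_nonpos)
qed

theorem theorem2p7:
  fixes \<alpha> \<beta> :: real and f :: "complex \<Rightarrow> complex"
  assumes "\<alpha> > 0" and "\<beta> \<ge> 0"
    and "f \<in> class_A"
    and "\<forall>z\<in>unit_disc. ffz f z \<noteq> 0"
    and "(\<forall>z\<in>unit_disc. Re (of_real \<beta> * Q_SD f z * Q_ST f z
            + of_real \<alpha> * Q_CV f z * (1 + Q_ST f z)) > - \<alpha> / 2)
       \<or> (\<forall>z\<in>unit_disc. Re (of_real \<beta> * Q_SD f z * Q_CV f z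
            + of_real \<alpha> * Q_ST f z * (1 + Q_CV f z)) > - \<alpha> / 2)
       \<or> (\<forall>z\<in>unit_disc. Re (of_real \<beta> * Q_SD f z * Q_CV f z
            + of_real \<alpha> * Q_CV f z * (1 + Q_ST f z)) > - \<alpha> / 2)
       \<or> (\<forall>z\<in>unit_disc. Re (of_real \<beta> * Q_SD f z * Q_ST f z
            + of_real \<alpha> * Q_ST f z * (1 + Q_CV f z)) > - \<alpha> / 2)"
  shows "starlike_fun f"
proof (rule ccontr)
  assume "\<not> starlike_fun f"
  then obtain z where z: "z \<in> unit_disc" "Re (Q_ST f z) \<le> 0"
    using \<open>f \<in> class_A\<close> by (force simp: starlike_fun_def)
  note f = \<open>f \<in> class_A\<close> and nz = \<open>\<forall>z\<in>unit_disc. ffz f z \<noteq> 0\<close>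
  have Q_ST_0: "Q_ST f 0 = 1"
    by (simp add: Q_ST_def)
  obtain z0 x y where z0: "z0 \<in> unit_disc" "z0 \<noteq> 0"
    and p: "Q_ST f z0 = \<i> * complex_of_real x"
    and D: "z0 * deriv (Q_ST f) z0 = complex_of_real y"
    and y: "y \<le> - (1 + x\<^sup>2) / 2"
    and W: "Re (z0 * deriv (\<lambda>z. z * deriv (Q_ST f) z) z0) \<le> 0"
    using first_zero_of_Re_derivatives[OF Q_ST_holomorphic[OF f nz] Q_ST_0 z] by metis
  have "Q_ST f z0 \<noteq> 0"
    using ffz_nonzero_factors[OF nz z0] z0 by (simp add: Q_ST_def)
  then have "x \<noteq> 0"
    using p by auto
  note signs = Q_at_first_zero[OF this y W p Q_CV_eq[OF f nz z0, unfolded D]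
      Q_SD_eq[OF f nz z0, unfolded deriv_Q_CV[OF f nz z0] D]]
  have \<alpha>: "\<alpha> * Re (Q_ST f z0 * Q_CV f z0) \<le> \<alpha> * (- 1 / 2)"
    using signs(3) \<open>\<alpha> > 0\<close> by (intro mult_left_mono) auto
  \<comment> \<open>The four expressions share one shape: \<open>r\<close> is the factor that multiplies \<open>Q_SD f\<close>, and
      \<open>a\<close>, \<open>b\<close> are \<open>Q_ST f\<close> and \<open>Q_CV f\<close> in either order.\<close>
  have bound: "Re (of_real \<beta> * Q_SD f z0 * r + of_real \<alpha> * a * (1 + b)) \<le> - \<alpha> / 2"
    if "Re (Q_SD f z0 * r) \<le> 0" "Re a = 0" "a * b = Q_ST f z0 * Q_CV f z0" for r a b
  proof -
    have "of_real \<beta> * Q_SD f z0 * r + of_real \<alpha> * a * (1 + b)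
        = of_real \<beta> * (Q_SD f z0 * r) + of_real \<alpha> * a + of_real \<alpha> * (a * b)"
      by (simp add: algebra_simps)
    then have "Re (of_real \<beta> * Q_SD f z0 * r + of_real \<alpha> * a * (1 + b))
        = \<beta> * Re (Q_SD f z0 * r) + \<alpha> * Re (Q_ST f z0 * Q_CV f z0)"
      using that(2,3) by (simp only: plus_complex.sel) simp
    moreover have "\<beta> * Re (Q_SD f z0 * r) \<le> 0"
      using that(1) \<open>\<beta> \<ge> 0\<close> by (simp add: mult_nonneg_nonpos)
    ultimately show ?thesis
      using \<alpha> by linarith
  qed
  note bounds = bound[OF signs(4) signs(2) mult.commute] bound[OF signs(5) signs(1) refl]
    bound[OF signs(5) signs(2) mult.commute] bound[OF signs(4) signs(1) refl]
  show False
    using assms(5) z0(1) bounds by (meson not_less)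
qed

end
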